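(* Let $R$ be a finite commutative ring with unity, written as $R = R_1\times\cdots\times R_s$ with $R_i$ finite local rings, let $x = (x_1,\dots,x_s)$ be a nonzero element of $R$, and let $P = \{ i \in\{1,\dots,s\} : x_i \neq 0\}$. Then the energy of $\mathrm{Cay}(R, xR^* )$ is $2^{|P|}\frac{|R|\,|xR^*|}{|I_x|}$.
   Context: $R^*$ is the unit group of $R$, $xR^*=\{xr: r\in R^*\}$, $I_x$ is the ideal of $R$ generated by $x$. $\mathrm{Cay}(R, xR^* )$ is the graph with vertex set $R$ in which $u,v$ are adjacent iff $u - v\in xR^*$. The energy of a graph is the sum of the absolute values of the eigenvalues of its $(0,1)$-adjacency matrix, counted with multiplicity. *)

theory Defs
  imports
    "HOL-Algebra.Chinese_Remainder"
    "Graph_Theory.Pair_Digraph"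
    "Jordan_Normal_Form.Spectral_Radius"
begin

definition local_ring :: "('a, 'm) ring_scheme \<Rightarrow> bool" where
  "local_ring R \<longleftrightarrow> cring R \<and> (\<exists>!M. maximalideal M R)"

text \<open>An undirected graph is a symmetric digraph here; see \<open>Cay_pair_graph\<close> below.\<close>

definition Cay :: "('a, 'm) ring_scheme \<Rightarrow> 'a set \<Rightarrow> 'a pair_pre_digraph" where
  "Cay R S = \<lparr> pverts = carrier R,
               parcs = {(u, v). u \<in> carrier R \<and> v \<in> carrier R \<and> u \<ominus>\<^bsub>R\<^esub> v \<in> S} \<rparr>"

text \<open>The list \<open>vs\<close> enumerates the vertices without repetition.\<close>

definition adjacency_mat :: "'v pair_pre_digraph \<Rightarrow> 'v list \<Rightarrow> complex mat" where
  "adjacency_mat G vs =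
     mat (length vs) (length vs) (\<lambda>(i, j). if (vs ! i, vs ! j) \<in> parcs G then 1 else 0)"

text \<open>The multiplicity of an eigenvalue is its order as a root of the characteristic polynomial
  over the complex numbers, so that no eigenvalue is missed. The qualified name is needed because
  \<open>order\<close> also denotes the order of a group.\<close>

definition mat_energy :: "complex mat \<Rightarrow> real" where
  "mat_energy A = (\<Sum>e\<in>spectrum A. real (Polynomial.order e (char_poly A)) * cmod e)"

text \<open>The choice of the enumeration is irrelevant: see \<open>graph_energy_eq\<close> below.\<close>

definition graph_energy :: "'v pair_pre_digraph \<Rightarrow> real" where
  "graph_energy G = mat_energy (adjacency_mat G (SOME vs. distinct vs \<and> set vs = pverts G))"

lemma mat_energy_similar:
  assumes "similar_mat A B"
  shows "mat_energy A = mat_energy B"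
proof -
  obtain n where n: "A \<in> carrier_mat n n" "B \<in> carrier_mat n n"
    using similar_matD[OF assms] by auto
  have cp: "char_poly A = char_poly B" by (rule char_poly_similar[OF assms])
  have "spectrum A = spectrum B"
    using spectrum_root_char_poly[OF n(1)] spectrum_root_char_poly[OF n(2)] cp by simp
  then show ?thesis by (simp add: mat_energy_def cp)
qed

lemma adjacency_mat_similar:
  assumes vs: "distinct vs" "set vs = V" and ws: "distinct ws" "set ws = V"
  shows "similar_mat (adjacency_mat G vs) (adjacency_mat G ws)"
proof -
  define n where "n = length vs"
  have lw: "length ws = n" using distinct_card vs ws unfolding n_def by metis
  define P :: "complex mat" where "P = mat n n (\<lambda>(i, j). if vs ! i = ws ! j then 1 else 0)"
  define Q :: "complex mat" where "Q = mat n n (\<lambda>(i, j). if ws ! i = vs ! j then 1 else 0)"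
  have sum_at: "(\<Sum>k\<in>{0..<n}. (if us ! k = v then f k else 0)) = (f j :: complex)"
    if "distinct us" "length us = n" "j < n" "us ! j = v" for us v j f
  proof -
    have "(\<Sum>k\<in>{0..<n}. (if us ! k = v then f k else 0)) = (\<Sum>k\<in>{0..<n}. if k = j then f k else 0)"
      using that by (intro sum.cong) (auto simp: nth_eq_iff_index_eq)
    then show ?thesis using that by simp
  qed
  have idx: "\<exists>j<n. ws ! j = vs ! i" "\<exists>j<n. vs ! j = ws ! i" if "i < n" for i
    using that vs ws lw n_def by (metis in_set_conv_nth)+
  have C: "P \<in> carrier_mat n n" "Q \<in> carrier_mat n n"
    "adjacency_mat G vs \<in> carrier_mat n n" "adjacency_mat G ws \<in> carrier_mat n n"
    by (auto simp: P_def Q_def adjacency_mat_def n_def lw[unfolded n_def])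
  have PQ: "P * Q = 1\<^sub>m n"
  proof (rule eq_matI)
    fix i j assume "i < dim_row (1\<^sub>m n :: complex mat)" "j < dim_col (1\<^sub>m n :: complex mat)"
    then have ij: "i < n" "j < n" by auto
    obtain k where k: "k < n" "ws ! k = vs ! i" using idx ij by blast
    have "(P * Q) $$ (i, j) =
        (\<Sum>l\<in>{0..<n}. if ws ! l = vs ! i then (if ws ! l = vs ! j then 1 else 0) else 0)"
      using ij by (auto simp: P_def Q_def scalar_prod_def intro!: sum.cong)
    also have "\<dots> = (if ws ! k = vs ! j then 1 else 0)"
      by (rule sum_at[OF ws(1) lw k])
    finally show "(P * Q) $$ (i, j) = 1\<^sub>m n $$ (i, j)"
      using ij k vs(1) by (auto simp: nth_eq_iff_index_eq n_def)
  qed (auto simp: P_def Q_def)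
  have QP: "Q * P = 1\<^sub>m n"
    using mat_mult_left_right_inverse[OF C(1,2) PQ] .
  have APPB: "adjacency_mat G vs * P = P * adjacency_mat G ws"
  proof (rule eq_matI)
    fix i j assume "i < dim_row (P * adjacency_mat G ws)" "j < dim_col (P * adjacency_mat G ws)"
    then have ij: "i < n" "j < n" using C by auto
    obtain k where k: "k < n" "ws ! k = vs ! i" using idx ij by blast
    obtain m where m: "m < n" "vs ! m = ws ! j" using idx ij by blast
    have "(adjacency_mat G vs * P) $$ (i, j) =
        (\<Sum>l\<in>{0..<n}. if vs ! l = ws ! j then (if (vs ! i, vs ! l) \<in> parcs G then 1 else 0) else 0)"
      using ij by (auto simp: P_def adjacency_mat_def scalar_prod_def n_def intro!: sum.cong)
    also have "\<dots> = (if (vs ! i, vs ! m) \<in> parcs G then 1 else 0)"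
      by (rule sum_at[OF vs(1) n_def[symmetric] m])
    also have "\<dots> = (if (ws ! k, ws ! j) \<in> parcs G then 1 else 0)" using k m by simp
    also have "\<dots> = (\<Sum>l\<in>{0..<n}. if ws ! l = vs ! i then (if (ws ! l, ws ! j) \<in> parcs G then 1 else 0) else 0)"
      by (rule sum_at[OF ws(1) lw k, symmetric])
    also have "\<dots> = (P * adjacency_mat G ws) $$ (i, j)"
      using ij by (auto simp: P_def adjacency_mat_def scalar_prod_def lw intro!: sum.cong)
    finally show "(adjacency_mat G vs * P) $$ (i, j) = (P * adjacency_mat G ws) $$ (i, j)" .
  qed (use C in auto)
  have "adjacency_mat G vs = adjacency_mat G vs * (P * Q)" using C PQ by simp
  also have "\<dots> = P * adjacency_mat G ws * Q"
    using assoc_mult_mat[OF C(3) C(1) C(2)] APPB by simp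
  finally have "similar_mat_wit (adjacency_mat G vs) (adjacency_mat G ws) P Q"
    using C PQ QP by (auto simp: similar_mat_wit_def Let_def)
  then show ?thesis unfolding similar_mat_def by blast
qed

lemma graph_energy_eq:
  assumes "distinct vs" "set vs = pverts G"
  shows "graph_energy G = mat_energy (adjacency_mat G vs)"
proof -
  let ?ws = "SOME vs. distinct vs \<and> set vs = pverts G"
  have "distinct ?ws \<and> set ?ws = pverts G" by (rule someI[of _ vs]) (use assms in auto)
  then show ?thesis
    unfolding graph_energy_def using mat_energy_similar[OF adjacency_mat_similar] assms by blast
qed

text \<open>For nonzero \<open>x\<close> the graph \<open>Cay(R, xR\<^sup>*)\<close> is indeed simple and undirected.\<close>

lemma Cay_pair_graph:
  assumes "cring R" "finite (carrier R)" "x \<in> carrier R" "x \<noteq> \<zero>\<^bsub>R\<^esub>"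
  shows "pair_graph (Cay R (x <#\<^bsub>R\<^esub> Units R))"
proof -
  interpret cring R by fact
  let ?S = "x <#\<^bsub>R\<^esub> Units R"
  have fin: "finite (parcs (Cay R ?S))"
    by (rule finite_subset[of _ "carrier R \<times> carrier R"]) (use assms in \<open>auto simp: Cay_def\<close>)
  have zero: "\<zero>\<^bsub>R\<^esub> \<notin> ?S"
  proof
    assume "\<zero>\<^bsub>R\<^esub> \<in> ?S"
    then obtain r where r: "r \<in> Units R" "x \<otimes>\<^bsub>R\<^esub> r = \<zero>\<^bsub>R\<^esub>" by (auto simp: l_coset_def)
    have "x = x \<otimes>\<^bsub>R\<^esub> r \<otimes>\<^bsub>R\<^esub> inv\<^bsub>R\<^esub> r"
      using m_assoc[of x r "inv\<^bsub>R\<^esub> r"] r(1) assms(3) by (simp add: Units_closed)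
    also have "\<dots> = \<zero>\<^bsub>R\<^esub>" unfolding r(2) using r(1) by simp
    finally show False using assms by simp
  qed
  have neg: "v \<ominus>\<^bsub>R\<^esub> u \<in> ?S" if uv: "u \<in> carrier R" "v \<in> carrier R" "u \<ominus>\<^bsub>R\<^esub> v \<in> ?S" for u v
  proof -
    obtain r where r: "r \<in> Units R" "u \<ominus>\<^bsub>R\<^esub> v = x \<otimes>\<^bsub>R\<^esub> r"
      using uv(3) unfolding l_coset_def by blast
    have "v \<ominus>\<^bsub>R\<^esub> u = \<ominus>\<^bsub>R\<^esub> (u \<ominus>\<^bsub>R\<^esub> v)"
      using uv by (simp add: a_minus_def minus_add a_comm)
    also have "\<dots> = x \<otimes>\<^bsub>R\<^esub> (\<ominus>\<^bsub>R\<^esub> r)" using r assms by (simp add: r_minus Units_closed)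
    finally have *: "v \<ominus>\<^bsub>R\<^esub> u = x \<otimes>\<^bsub>R\<^esub> (\<ominus>\<^bsub>R\<^esub> r)" .
    have "(\<ominus>\<^bsub>R\<^esub> \<one>\<^bsub>R\<^esub>) \<otimes>\<^bsub>R\<^esub> r \<in> Units R"
      using Units_m_closed[OF Units_minus_one_closed r(1)] .
    then have "\<ominus>\<^bsub>R\<^esub> r \<in> Units R" using r(1) by (simp add: l_minus Units_closed)
    then show ?thesis unfolding * l_coset_def by blast
  qed
  show ?thesis
  proof unfold_locales
    show "symmetric (with_proj (Cay R ?S))"
      using neg by (auto simp: symmetric_def sym_def arcs_ends_def arc_to_ends_def
          with_proj_def Cay_def image_iff)
  qed (use fin zero assms in \<open>auto simp: Cay_def a_minus_def r_neg\<close>)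
qed

end

theory Submission
  imports Defs
begin

text \<open>
  If the traces of all powers of a matrix have the form \<open>tr (A ^ m) = \<Sum>g. w g * c g ^ m\<close>, then
  interpolating the modulus by a polynomial at the eigenvalues and at the \<open>c g\<close> shows that the
  energy is \<open>\<Sum>g. w g * \<bar>c g\<bar>\<close>. For a Cayley graph on a finite ring \<open>tr (A ^ m)\<close> is \<open>\<bar>R\<bar>\<close> times the
  number of \<open>m\<close>-tuples of elements of the connection set with sum zero, and this number is
  multiplicative over products of rings. In a local ring with maximal ideal \<open>M\<close> and \<open>x \<noteq> 0\<close>, the
  connection set is \<open>x R - x M\<close>, a difference of two nested additive subgroups \<open>J \<subseteq> I\<close>; their
  indicators are, up to scaling, commuting idempotents under convolution, which gives the
  eigenvalues \<open>\<bar>I\<bar> - \<bar>J\<bar>\<close>, \<open>- \<bar>J\<bar>\<close> and \<open>0\<close>.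
\<close>

section \<open>Energy from traces of powers\<close>

text \<open>Induction on the set: the product \<open>q\<close> of linear factors vanishes on the old
  points but not at the new point \<open>a\<close>, so a suitable multiple of it corrects the value
  there and nowhere else.\<close>

lemma interpolation_exists:
  fixes f :: "'a :: field \<Rightarrow> 'a"
  assumes "finite Z"
  shows "\<exists>p. \<forall>z\<in>Z. poly p z = f z"
  using assms
proof induction
  case empty
  show ?case by simp
next
  case (insert a Z)
  then obtain p where p: "\<forall>z\<in>Z. poly p z = f z" by blast
  define q where "q = (\<Prod>z\<in>Z. [:- z, 1:])"
  have q0: "poly q z = 0" if "z \<in> Z" for z
    using that insert.hyps unfolding q_def by (auto simp: poly_prod)
  have qa: "poly q a \<noteq> 0"
    using insert.hyps unfolding q_def by (auto simp: poly_prod)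
  show ?case
    by (rule exI[of _ "p + Polynomial.smult ((f a - poly p a) / poly q a) q"])
      (use p q0 qa in auto)
qed

text \<open>Both sides are linear in \<open>f\<close>, and for monomials they agree by hypothesis,
  hence also for polynomials. Only the finitely many values of \<open>f\<close> at the points
  \<open>d i\<close> and \<open>c g\<close> matter, and there \<open>f\<close> coincides with an
  interpolation polynomial. The \<open>c g\<close> may coincide and the weights are
  arbitrary.\<close>

lemma power_sums_determine_sums:
  fixes d :: "nat \<Rightarrow> 'a :: field" and w c :: "'b \<Rightarrow> 'a"
  assumes G: "finite G"
    and pow: "\<And>m. (\<Sum>i<n. d i ^ m) = (\<Sum>g\<in>G. w g * c g ^ m)"
  shows "(\<Sum>i<n. f (d i)) = (\<Sum>g\<in>G. w g * f (c g))"
proof -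
  obtain p where p: "\<forall>z \<in> d ` {..<n} \<union> c ` G. poly p z = f z"
    using interpolation_exists[of "d ` {..<n} \<union> c ` G" f] G by auto
  have "(\<Sum>i<n. f (d i)) = (\<Sum>i<n. poly p (d i))"
    using p by (intro sum.cong) auto
  also have "\<dots> = (\<Sum>k\<le>degree p. coeff p k * (\<Sum>i<n. d i ^ k))"
    unfolding poly_altdef sum_distrib_left by (rule sum.swap)
  also have "\<dots> = (\<Sum>k\<le>degree p. \<Sum>g\<in>G. w g * (coeff p k * c g ^ k))"
    unfolding pow sum_distrib_left by (simp add: mult.left_commute)
  also have "\<dots> = (\<Sum>g\<in>G. w g * poly p (c g))"
    unfolding poly_altdef sum_distrib_left by (rule sum.swap)
  also have "\<dots> = (\<Sum>g\<in>G. w g * f (c g))"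
    using p by (intro sum.cong) auto
  finally show ?thesis .
qed

section \<open>Traces under similarity and powers of triangular matrices\<close>

lemma diagonal_sum_mult_commute:
  fixes A B :: "'a :: comm_semiring_0 mat"
  assumes "A \<in> carrier_mat n n" "B \<in> carrier_mat n n"
  shows "(\<Sum>i<n. (A * B) $$ (i, i)) = (\<Sum>i<n. (B * A) $$ (i, i))"
proof -
  have "(\<Sum>i<n. (A * B) $$ (i, i)) = (\<Sum>i<n. \<Sum>k<n. A $$ (i, k) * B $$ (k, i))"
    using assms by (intro sum.cong) (auto simp: scalar_prod_def lessThan_atLeast0)
  also have "\<dots> = (\<Sum>k<n. \<Sum>i<n. B $$ (k, i) * A $$ (i, k))"
    by (subst sum.swap) (simp add: mult.commute)
  also have "\<dots> = (\<Sum>i<n. (B * A) $$ (i, i))"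
    using assms by (intro sum.cong) (auto simp: scalar_prod_def lessThan_atLeast0)
  finally show ?thesis .
qed

lemma diagonal_sum_similar:
  fixes A B :: "'a :: comm_ring_1 mat"
  assumes "similar_mat_wit A B P Q" "A \<in> carrier_mat n n"
  shows "(\<Sum>i<n. A $$ (i, i)) = (\<Sum>i<n. B $$ (i, i))"
proof -
  note w = similar_mat_witD2[OF assms(2,1)]
  have "(\<Sum>i<n. A $$ (i, i)) = (\<Sum>i<n. (P * (B * Q)) $$ (i, i))"
    using w by simp
  also have "\<dots> = (\<Sum>i<n. ((B * Q) * P) $$ (i, i))"
    by (rule diagonal_sum_mult_commute) (use w in auto)
  also have "(B * Q) * P = B"
    using w by (simp add: assoc_mult_mat[of _ n n _ n _ n])
  finally show ?thesis .
qed

text \<open>The entries below the diagonal are included because the induction for the diagonal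
  entries needs them to vanish.\<close>

lemma upper_triangular_pow:
  fixes B :: "'a :: comm_semiring_1 mat"
  assumes B: "B \<in> carrier_mat n n" "upper_triangular B" and "i < n" "j \<le> i"
  shows "(B ^\<^sub>m m) $$ (i, j) = (if i = j then B $$ (i, i) ^ m else 0)"
  using assms(3,4)
proof (induction m arbitrary: i j)
  case 0
  then show ?case using B by auto
next
  case (Suc m)
  have "(B ^\<^sub>m Suc m) $$ (i, j) = (\<Sum>k<n. (B ^\<^sub>m m) $$ (i, k) * B $$ (k, j))"
    using Suc.prems B by (auto simp: scalar_prod_def lessThan_atLeast0)
  \<comment> \<open>For \<open>k < i\<close> the left factor is 0 by the induction hypothesis; for
    \<open>k > i\<close> the right factor is 0 because then \<open>k > j\<close>.\<close>
  also have "\<dots> = (\<Sum>k<n. if k = i then (B ^\<^sub>m m) $$ (i, i) * B $$ (i, j) else 0)"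
  proof (intro sum.cong refl)
    fix k assume "k \<in> {..<n}"
    then show "(B ^\<^sub>m m) $$ (i, k) * B $$ (k, j) =
        (if k = i then (B ^\<^sub>m m) $$ (i, i) * B $$ (i, j) else 0)"
      using Suc.IH[of i k] Suc.prems B upper_triangularD[OF B(2), of j k]
      by (cases k i rule: linorder_cases) auto
  qed
  also have "\<dots> = (if i = j then B $$ (i, i) ^ Suc m else 0)"
    using Suc.IH[of i i] Suc.prems B upper_triangularD[OF B(2), of j i] by (auto simp: mult.commute)
  finally show ?case .
qed

lemma mat_energy_factorized:
  assumes A: "A \<in> carrier_mat n n" and cp: "char_poly A = (\<Prod>a\<leftarrow>es. [:- a, 1:])"
  shows "mat_energy A = (\<Sum>a\<leftarrow>es. cmod a)"
proof -
  have "spectrum A = set es"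
    unfolding spectrum_root_char_poly[OF A] cp
    by (auto simp: poly_prod_list prod_list_zero_iff)
  moreover have "Polynomial.order e (char_poly A) = count_list es e" for e
    unfolding cp
    by (subst order_prod_list, force, induction es) (auto simp: order_linear')
  \<comment> \<open>The index set is a fixed superset \<open>X\<close> of the entries, so that it
    does not change while the list grows in the induction.\<close>
  moreover have "(\<Sum>e\<in>X. real (count_list xs e) * cmod e) = (\<Sum>a\<leftarrow>xs. cmod a)"
    if "finite X" "set xs \<subseteq> X" for X xs
    using that
  proof (induction xs)
    case (Cons a xs)
    have "(\<Sum>e\<in>X. real (count_list (a # xs) e) * cmod e) =
        (\<Sum>e\<in>X. (if e = a then cmod e else 0) + real (count_list xs e) * cmod e)"
      by (intro sum.cong) (simp_all add: distrib_right)
    then show ?case using Cons by (simp add: sum.distrib)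
  qed simp
  ultimately show ?thesis
    by (simp add: mat_energy_def)
qed

text \<open>After Schur triangularization the diagonal entries \<open>d i\<close> are the
  eigenvalues with multiplicity, and the traces of powers are their power sums. The power sums then
  determine the sum of the moduli, so the \<open>c g\<close> need not be identified with eigenvalues
  one by one.\<close>

lemma mat_energy_from_power_traces:
  fixes w c :: "'b \<Rightarrow> complex"
  assumes A: "A \<in> carrier_mat n n" and G: "finite G"
    and tr: "\<And>m. (\<Sum>i<n. (A ^\<^sub>m m) $$ (i, i)) = (\<Sum>g\<in>G. w g * c g ^ m)"
  shows "complex_of_real (mat_energy A) = (\<Sum>g\<in>G. w g * of_real (cmod (c g)))"
proof -
  obtain es where es: "char_poly A = (\<Prod>a\<leftarrow>es. [:- a, 1:])"
    using char_poly_factorized[OF A] by blast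
  obtain B where B: "B \<in> carrier_mat n n" "upper_triangular B" "similar_mat A B"
    using schur_upper_triangular[OF A es] by blast
  obtain P Q where wit: "similar_mat_wit A B P Q"
    using B(3) unfolding similar_mat_def by blast
  define d where "d = (\<lambda>i. B $$ (i, i))"
  have "char_poly A = (\<Prod>a\<leftarrow>diag_mat B. [:- a, 1:])"
    using char_poly_similar[OF B(3)] char_poly_upper_triangular[OF B(1,2)] by simp
  then have "mat_energy A = (\<Sum>a\<leftarrow>diag_mat B. cmod a)"
    by (rule mat_energy_factorized[OF A])
  also have "\<dots> = (\<Sum>i<n. cmod (d i))"
    using B(1) by (simp add: diag_mat_def d_def sum_list_distinct_conv_sum_set lessThan_atLeast0 comp_def)
  finally have en: "mat_energy A = (\<Sum>i<n. cmod (d i))" .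
  have "(\<Sum>i<n. d i ^ m) = (\<Sum>g\<in>G. w g * c g ^ m)" for m
  proof -
    have "(\<Sum>i<n. (A ^\<^sub>m m) $$ (i, i)) = (\<Sum>i<n. (B ^\<^sub>m m) $$ (i, i))"
      by (rule diagonal_sum_similar[OF similar_mat_wit_pow[OF wit]]) (use A in auto)
    also have "\<dots> = (\<Sum>i<n. d i ^ m)"
      using upper_triangular_pow[OF B(1,2)] by (intro sum.cong) (auto simp: d_def)
    finally show ?thesis using tr by simp
  qed
  from power_sums_determine_sums[OF G this, of "\<lambda>z. of_real (cmod z)"]
  show ?thesis unfolding en by simp
qed

section \<open>Sums of elements of the connection set\<close>

text \<open>For finite \<open>S\<close> inside the carrier and \<open>z\<close> in the carrier this
  counts the \<open>m\<close>-tuples from \<open>S\<close> with sum \<open>z\<close>; it is the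
  \<open>m\<close>-fold convolution power of the indicator of \<open>S\<close>. The values are
  complex so that they can be expanded in powers of eigenvalues.\<close>

primrec sum_reps :: "('a, 'm) ring_scheme \<Rightarrow> 'a set \<Rightarrow> nat \<Rightarrow> 'a \<Rightarrow> complex" where
  "sum_reps R S 0 z = (if z = \<zero>\<^bsub>R\<^esub> then 1 else 0)"
| "sum_reps R S (Suc m) z = (\<Sum>s\<in>S. sum_reps R S m (z \<ominus>\<^bsub>R\<^esub> s))"

context ring
begin

section \<open>Differences and translations in a ring\<close>

lemma minus_minus_add:
  assumes "a \<in> carrier R" "b \<in> carrier R" "s \<in> carrier R"
  shows "a \<ominus> (b \<oplus> s) = a \<ominus> b \<ominus> s"
  using assms by (simp add: a_minus_def minus_add a_assoc)

lemma minus_add_cancel: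
  assumes "a \<in> carrier R" "b \<in> carrier R"
  shows "(a \<ominus> b) \<oplus> b = a" "(a \<oplus> b) \<ominus> b = a" "b \<oplus> (a \<ominus> b) = a" "(b \<oplus> a) \<ominus> b = a"
proof -
  show 1: "(a \<ominus> b) \<oplus> b = a" "(a \<oplus> b) \<ominus> b = a"
    using assms by (simp_all add: a_minus_def a_assoc l_neg r_neg)
  show "b \<oplus> (a \<ominus> b) = a" "(b \<oplus> a) \<ominus> b = a"
    using assms 1 by (simp_all add: a_comm)
qed

lemma minus_eq_zero_iff:
  assumes "a \<in> carrier R" "b \<in> carrier R"
  shows "a \<ominus> b = \<zero> \<longleftrightarrow> a = b"
proof
  assume "a \<ominus> b = \<zero>"
  then show "a = b" using minus_add_cancel(1)[OF assms] assms by simp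
qed (use assms in \<open>simp add: a_minus_def r_neg\<close>)

lemma minus_cancel:
  assumes "a \<in> carrier R" "b \<in> carrier R"
  shows "a \<ominus> (a \<ominus> b) = b"
proof -
  have "a \<ominus> (a \<ominus> b) = a \<oplus> (b \<ominus> a)"
    using assms by (simp add: a_minus_def minus_add a_comm)
  then show ?thesis using minus_add_cancel(3)[of b a] assms by simp
qed

lemma sum_translate:
  fixes f :: "'a \<Rightarrow> complex"
  assumes S: "S \<subseteq> carrier R" and a: "a \<in> carrier R" and fin: "finite (carrier R)"
  shows "(\<Sum>v\<in>carrier R. if v \<ominus> a \<in> S then f v else 0) = (\<Sum>s\<in>S. f (a \<oplus> s))"
proof -
  have "(\<Sum>v\<in>carrier R. if v \<ominus> a \<in> S then f v else 0) =
      (\<Sum>v\<in>{v \<in> carrier R. v \<ominus> a \<in> S}. f v)"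
    using fin by (simp add: sum.inter_filter)
  also have "\<dots> = (\<Sum>s\<in>S. f (a \<oplus> s))"
    by (rule sum.reindex_bij_witness[of _ "\<lambda>s. a \<oplus> s" "\<lambda>v. v \<ominus> a"])
      (use S a in \<open>auto simp: minus_add_cancel subset_iff\<close>)
  finally show ?thesis .
qed

text \<open>The entry counts walks of length \<open>m\<close>. A walk is determined by its
  differences of consecutive vertices, which lie in \<open>S\<close> and add up to the start minus
  the end.\<close>

lemma adjacency_mat_Cay_pow:
  assumes fin: "finite (carrier R)" and S: "S \<subseteq> carrier R"
    and vs: "distinct vs" "set vs = carrier R" and ij: "i < length vs" "j < length vs"
  shows "(adjacency_mat (Cay R S) vs ^\<^sub>m m) $$ (i, j) = sum_reps R S m (vs ! i \<ominus> vs ! j)"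
  using ij
proof (induction m arbitrary: j)
  case 0
  have "vs ! i \<in> carrier R" "vs ! j \<in> carrier R"
    unfolding vs(2)[symmetric] using 0 by simp_all
  then have "vs ! i \<ominus> vs ! j = \<zero> \<longleftrightarrow> vs ! i = vs ! j"
    by (rule minus_eq_zero_iff)
  then show ?case
    using 0 vs by (auto simp: adjacency_mat_def nth_eq_iff_index_eq)
next
  case (Suc m)
  let ?A = "adjacency_mat (Cay R S) vs"
  have A: "?A \<in> carrier_mat (length vs) (length vs)"
    by (simp add: adjacency_mat_def)
  have mem: "vs ! k \<in> carrier R" if "k < length vs" for k
    unfolding vs(2)[symmetric] using that by simp
  have "(?A ^\<^sub>m Suc m) $$ (i, j) = (\<Sum>k<length vs. (?A ^\<^sub>m m) $$ (i, k) * ?A $$ (k, j))"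
    using Suc.prems A by (auto simp: scalar_prod_def lessThan_atLeast0)
  also have "\<dots> = (\<Sum>k<length vs.
      if vs ! k \<ominus> vs ! j \<in> S then sum_reps R S m (vs ! i \<ominus> vs ! k) else 0)"
    using Suc mem by (intro sum.cong) (auto simp: adjacency_mat_def Cay_def)
  \<comment> \<open>From indices to vertices. The last arc of the walk leads from \<open>v\<close>
    to \<open>vs ! j\<close>, so next \<open>v\<close> is replaced by \<open>vs ! j\<close> plus an
    element of \<open>S\<close>.\<close>
  also have "\<dots> = (\<Sum>v\<in>carrier R. if v \<ominus> vs ! j \<in> S then sum_reps R S m (vs ! i \<ominus> v) else 0)"
    by (rule sum.reindex_bij_betw) (use bij_betw_nth[OF vs(1)] vs(2) in auto)
  also have "\<dots> = (\<Sum>s\<in>S. sum_reps R S m (vs ! i \<ominus> (vs ! j \<oplus> s)))"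
    by (rule sum_translate) (use S mem Suc.prems fin in auto)
  also have "\<dots> = sum_reps R S (Suc m) (vs ! i \<ominus> vs ! j)"
    using S mem Suc.prems by (auto intro!: sum.cong simp: minus_minus_add subset_iff)
  finally show ?case .
qed

text \<open>By translation invariance every diagonal entry of the \<open>m\<close>-th power is
  \<open>sum_reps R S m \<zero>\<close>, so the trace is this number times the order of the ring;
  that factor is absorbed into the weights.\<close>

lemma graph_energy_Cay:
  fixes w c :: "'g \<Rightarrow> complex"
  assumes fin: "finite (carrier R)" and S: "S \<subseteq> carrier R" and G: "finite G"
    and reps: "\<And>m. sum_reps R S m \<zero> = (\<Sum>g\<in>G. w g * c g ^ m)"
  shows "complex_of_real (graph_energy (Cay R S)) =
    of_nat (card (carrier R)) * (\<Sum>g\<in>G. w g * of_real (cmod (c g)))"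
proof -
  obtain vs where vs: "set vs = carrier R" "distinct vs"
    using finite_distinct_list[OF fin] by blast
  let ?A = "adjacency_mat (Cay R S) vs" and ?n = "length vs"
  have n: "?n = card (carrier R)" using vs distinct_card by metis
  have A: "?A \<in> carrier_mat ?n ?n" by (simp add: adjacency_mat_def)
  have "(\<Sum>i<?n. (?A ^\<^sub>m m) $$ (i, i)) = (\<Sum>g\<in>G. of_nat ?n * w g * c g ^ m)" for m
  proof -
    have "(?A ^\<^sub>m m) $$ (i, i) = sum_reps R S m \<zero>" if i: "i < ?n" for i
    proof -
      have "vs ! i \<in> carrier R" unfolding vs(1)[symmetric] using i by simp
      then show ?thesis
        using adjacency_mat_Cay_pow[OF fin S vs(2,1) i i] by (simp add: a_minus_def r_neg)
    qed
    then show ?thesis by (simp add: reps sum_distrib_left mult.assoc)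
  qed
  from mat_energy_from_power_traces[OF A G this]
  show ?thesis
    using vs n by (simp add: graph_energy_eq Cay_def sum_distrib_left mult.assoc)
qed

section \<open>Convolution of indicators of additive subgroups\<close>

lemma minus_mem_additive_subgroup_iff:
  assumes "additive_subgroup K R" "z \<in> carrier R" "s \<in> K"
  shows "z \<ominus> s \<in> K \<longleftrightarrow> z \<in> K"
proof -
  interpret additive_subgroup K R by fact
  have s: "s \<in> carrier R" using assms a_subset by blast
  show ?thesis
  proof
    assume "z \<ominus> s \<in> K"
    then have "(z \<ominus> s) \<oplus> s \<in> K" using assms(3) by (rule a_closed)
    then show "z \<in> K" unfolding minus_add_cancel(1)[OF assms(2) s] .
  next
    assume "z \<in> K"
    then show "z \<ominus> s \<in> K" unfolding a_minus_def using assms(3) by (intro a_closed a_inv_closed)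
  qed
qed

text \<open>These are the two orders of convolving the indicators of \<open>J\<close> and
  \<open>I\<close>; either way the result is card \<open>J\<close> times the indicator of
  \<open>I\<close>. For \<open>z\<close> in \<open>I\<close> the first sum counts the elements of
  \<open>z - J\<close>, all of which lie in \<open>I\<close>.\<close>

lemma sum_subgroup_indicator_translate:
  assumes I: "additive_subgroup I R" and J: "additive_subgroup J R" and JI: "J \<subseteq> I"
    and z: "z \<in> carrier R" and fin: "finite (carrier R)"
  shows "(\<Sum>s\<in>I. of_bool (z \<ominus> s \<in> J)) = (of_nat (card J) * of_bool (z \<in> I) :: complex)"
    and "(\<Sum>s\<in>J. of_bool (z \<ominus> s \<in> I)) = (of_nat (card J) * of_bool (z \<in> I) :: complex)"
proof -
  have sub: "I \<subseteq> carrier R" using additive_subgroup.a_subset[OF I] .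
  then have finI: "finite I" using fin finite_subset by blast
  have "card {s \<in> I. z \<ominus> s \<in> J} = card J" if "z \<in> I"
  \<comment> \<open>Subtraction from \<open>z\<close> is an involution, hence serves as its own
    inverse.\<close>
  proof (rule bij_betw_same_card[of "\<lambda>s. z \<ominus> s"], rule bij_betw_byWitness[of _ "\<lambda>s. z \<ominus> s"])
    show "(\<lambda>s. z \<ominus> s) ` J \<subseteq> {s \<in> I. z \<ominus> s \<in> J}"
      using minus_mem_additive_subgroup_iff[OF I z] JI that sub z
      by (auto simp: minus_cancel subset_iff)
  qed (use sub JI z in \<open>auto simp: minus_cancel subset_iff\<close>)
  moreover have "{s \<in> I. z \<ominus> s \<in> J} = {}" if "z \<notin> I"
    using minus_mem_additive_subgroup_iff[OF I z] JI that by auto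
  ultimately show "(\<Sum>s\<in>I. of_bool (z \<ominus> s \<in> J)) = (of_nat (card J) * of_bool (z \<in> I) :: complex)"
    using finI by (cases "z \<in> I") (simp_all add: Int_def)
  show "(\<Sum>s\<in>J. of_bool (z \<ominus> s \<in> I)) = (of_nat (card J) * of_bool (z \<in> I) :: complex)"
    using minus_mem_additive_subgroup_iff[OF I z] JI by (simp add: subset_iff)
qed

text \<open>Let e and f be the indicators of \<open>I\<close> and \<open>J\<close> divided by their
  cardinalities, and let d be the indicator of zero, the unit for convolution. Then e, f - e and d -
  f are orthogonal idempotents with sum d, and the indicator of \<open>I - J\<close> is (card
  \<open>I\<close> - card \<open>J\<close>) e - card \<open>J\<close> (f - e). Its
  \<open>m\<close>-th power is the stated combination; the last term is present only for
  \<open>m = 0\<close>, where \<open>0 ^ 0 = 1\<close>.\<close>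

lemma sum_reps_subgroup_diff:
  assumes I: "additive_subgroup I R" and J: "additive_subgroup J R" and JI: "J \<subseteq> I"
    and fin: "finite (carrier R)" and z: "z \<in> carrier R"
  shows "sum_reps R (I - J) m z =
    of_bool (z \<in> I) / of_nat (card I) * (of_nat (card I) - of_nat (card J)) ^ m
    + (of_bool (z \<in> J) / of_nat (card J) - of_bool (z \<in> I) / of_nat (card I)) * (- of_nat (card J)) ^ m
    + (of_bool (z = \<zero>) - of_bool (z \<in> J) / of_nat (card J)) * 0 ^ m"
  using z
proof (induction m arbitrary: z)
  case 0
  then show ?case by simp
next
  case (Suc m)
  let ?i = "of_nat (card I) :: complex" and ?j = "of_nat (card J) :: complex"
  have sub: "I \<subseteq> carrier R" "J \<subseteq> carrier R"
    using I J additive_subgroup.a_subset by blast+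
  then have finIJ: "finite I" "finite J" using fin finite_subset by blast+
  have zI: "\<zero> \<in> I" and zJ: "\<zero> \<in> J" using I J additive_subgroup.zero_closed by blast+
  then have ne: "?i \<noteq> 0" "?j \<noteq> 0" using finIJ by auto
  have diff: "(\<Sum>s\<in>I - J. f s) = (\<Sum>s\<in>I. f s) - (\<Sum>s\<in>J. f s)" for f :: "'a \<Rightarrow> complex"
    using finIJ JI by (simp add: sum_diff)
  have eq0: "z \<ominus> s = \<zero> \<longleftrightarrow> s = z" if "s \<in> carrier R" for s
    using minus_eq_zero_iff[of z s] that Suc.prems by auto
  have sI: "(\<Sum>s\<in>I - J. of_bool (z \<ominus> s \<in> I)) = (?i - ?j) * of_bool (z \<in> I)"
    unfolding diff using sum_subgroup_indicator_translate[OF I I _ Suc.prems fin]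
      sum_subgroup_indicator_translate[OF I J JI Suc.prems fin]
    by (simp add: algebra_simps)
  have sJ: "(\<Sum>s\<in>I - J. of_bool (z \<ominus> s \<in> J)) = ?j * of_bool (z \<in> I) - ?j * of_bool (z \<in> J)"
    unfolding diff using sum_subgroup_indicator_translate[OF J J _ Suc.prems fin]
      sum_subgroup_indicator_translate[OF I J JI Suc.prems fin]
    by simp
  have s0: "(\<Sum>s\<in>I - J. of_bool (z \<ominus> s = \<zero>)) = (of_bool (z \<in> I) - of_bool (z \<in> J) :: complex)"
  proof -
    have "(\<Sum>s\<in>I - J. of_bool (z \<ominus> s = \<zero>)) = (\<Sum>s\<in>I - J. of_bool (s = z) :: complex)"
      using eq0 sub by (intro sum.cong) auto
    also have "\<dots> = of_bool (z \<in> I - J)"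
      using finIJ by (simp add: of_bool_def)
    finally show ?thesis using JI by auto
  qed
  \<comment> \<open>The induction hypothesis is regrouped so that each summand is an indicator in
    \<open>s\<close> times a constant; \<open>sI\<close>, \<open>sJ\<close> and \<open>s0\<close>
    then evaluate the sums.\<close>
  have "sum_reps R (I - J) (Suc m) z = (\<Sum>s\<in>I - J.
      of_bool (z \<ominus> s \<in> I) * ((?i - ?j) ^ m / ?i)
      + (of_bool (z \<ominus> s \<in> J) * ((- ?j) ^ m / ?j) - of_bool (z \<ominus> s \<in> I) * ((- ?j) ^ m / ?i))
      + (of_bool (z \<ominus> s = \<zero>) * 0 ^ m - of_bool (z \<ominus> s \<in> J) * (0 ^ m / ?j)))"
    unfolding sum_reps.simps
  proof (intro sum.cong refl)
    fix s assume "s \<in> I - J"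
    then have "z \<ominus> s \<in> carrier R" using sub Suc.prems by auto
    from Suc.IH[OF this] show "sum_reps R (I - J) m (z \<ominus> s) =
      of_bool (z \<ominus> s \<in> I) * ((?i - ?j) ^ m / ?i)
      + (of_bool (z \<ominus> s \<in> J) * ((- ?j) ^ m / ?j) - of_bool (z \<ominus> s \<in> I) * ((- ?j) ^ m / ?i))
      + (of_bool (z \<ominus> s = \<zero>) * 0 ^ m - of_bool (z \<ominus> s \<in> J) * (0 ^ m / ?j))"
      by (simp only: left_diff_distrib times_divide_eq_right times_divide_eq_left)
  qed
  also have "\<dots> = (?i - ?j) * of_bool (z \<in> I) * ((?i - ?j) ^ m / ?i)
      + ((?j * of_bool (z \<in> I) - ?j * of_bool (z \<in> J)) * ((- ?j) ^ m / ?j)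
         - (?i - ?j) * of_bool (z \<in> I) * ((- ?j) ^ m / ?i))
      + ((of_bool (z \<in> I) - of_bool (z \<in> J)) * 0 ^ m
         - (?j * of_bool (z \<in> I) - ?j * of_bool (z \<in> J)) * (0 ^ m / ?j))"
    unfolding sum.distrib sum_subtractf sum_distrib_right[symmetric] sI sJ s0 ..
  also have "\<dots> = of_bool (z \<in> I) / ?i * (?i - ?j) ^ Suc m
      + (of_bool (z \<in> J) / ?j - of_bool (z \<in> I) / ?i) * (- ?j) ^ Suc m
      + (of_bool (z = \<zero>) - of_bool (z \<in> J) / ?j) * 0 ^ Suc m"
    using ne by (simp add: field_simps)
  finally show ?case .
qed

end

section \<open>Local rings\<close>

text \<open>The principal ideal of a nonunit is proper. As the ring is finite, some proper ideal
  containing \<open>a\<close> is maximal among such ideals, and it is a maximal ideal because every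
  larger ideal contains \<open>a\<close> as well.\<close>

lemma (in cring) nonunit_in_maximalideal:
  assumes fin: "finite (carrier R)" and a: "a \<in> carrier R" "a \<notin> Units R"
  shows "\<exists>M. maximalideal M R \<and> a \<in> M"
proof -
  let ?F = "{K. ideal K R \<and> K \<noteq> carrier R \<and> a \<in> K}"
  have "K \<subseteq> carrier R" if "ideal K R" for K
    using additive_subgroup.a_subset[OF ideal.axioms(1)[OF that]] .
  then have "?F \<subseteq> Pow (carrier R)" by auto
  then have "finite ?F" using fin by (simp add: finite_subset)
  moreover have "PIdl a \<in> ?F"
  proof -
    have "\<one> \<notin> PIdl a"
      using a m_comm unfolding cgenideal_def Units_def by auto
    then show ?thesis using cgenideal_ideal[OF a(1)] cgenideal_self[OF a(1)] by auto
  qed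
  ultimately obtain M where M: "M \<in> ?F" and max: "\<forall>K\<in>?F. M \<le> K \<longrightarrow> M = K"
    using finite_has_maximal[of ?F] by blast
  have "maximalideal M R"
    by (rule maximalidealI) (use M max in auto)
  then show ?thesis using M by blast
qed

text \<open>Left multiplication by \<open>x\<close> is additive, and \<open>x <# H\<close> is the
  image of \<open>H\<close> under it.\<close>

lemma (in ring) additive_subgroup_l_coset:
  assumes H: "additive_subgroup H R" and x: "x \<in> carrier R"
  shows "additive_subgroup (x <# H) R"
proof -
  interpret additive_subgroup H R by fact
  have H: "h \<in> carrier R" if "h \<in> H" for h using that a_subset by blast
  show ?thesis
  proof (rule additive_subgroup.intro, rule subgroup.intro)
    show "x <# H \<subseteq> carrier (add_monoid R)"
      using H x by (auto simp: l_coset_def)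
    show "\<one>\<^bsub>add_monoid R\<^esub> \<in> x <# H"
      unfolding l_coset_def using r_null[OF x] zero_closed by (metis UN_I insertI1 monoid.simps(2))
  next
    fix a assume "a \<in> x <# H"
    then obtain h where h: "h \<in> H" "a = x \<otimes> h" by (auto simp: l_coset_def)
    then have "\<ominus> a = x \<otimes> (\<ominus> h)" using h(1) H x by (simp add: r_minus)
    then show "inv\<^bsub>add_monoid R\<^esub> a \<in> x <# H"
      using a_inv_closed[OF h(1)] unfolding a_inv_def[symmetric] l_coset_def by auto
  next
    fix a b assume "a \<in> x <# H" "b \<in> x <# H"
    then obtain h k where h: "h \<in> H" "a = x \<otimes> h" "k \<in> H" "b = x \<otimes> k" by (auto simp: l_coset_def)
    then have "a \<oplus> b = x \<otimes> (h \<oplus> k)" using h(1,3) H x by (simp add: r_distr)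
    then show "a \<otimes>\<^bsub>add_monoid R\<^esub> b \<in> x <# H"
      using a_closed[OF h(1,3)] unfolding l_coset_def by auto
  qed
qed

text \<open>Covers the factors in which the component of \<open>x\<close> is zero, where the
  connection set is \<open>{\<zero>}\<close>.\<close>

lemma (in ring) sum_reps_zero:
  "sum_reps R {\<zero>} m \<zero> = 1"
  by (induction m) (simp_all add: a_minus_def)

text \<open>With \<open>M\<close> the unique maximal ideal, the carrier is the disjoint union of the
  units and \<open>M\<close>. Multiplication by \<open>x\<close> keeps the two images disjoint, so
  \<open>J\<close> is \<open>x <# M\<close>.\<close>

lemma (in cring) local_ring_l_coset_Units:
  assumes loc: "local_ring R" and fin: "finite (carrier R)" and x: "x \<in> carrier R" "x \<noteq> \<zero>"
  obtains J where "additive_subgroup J R" "J \<subseteq> x <# carrier R" "x <# Units R = (x <# carrier R) - J"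
proof -
  obtain M where M: "maximalideal M R" and uniq: "\<And>M'. maximalideal M' R \<Longrightarrow> M' = M"
    using loc unfolding local_ring_def by blast
  interpret M: maximalideal M R by fact
  have Mc: "m \<in> carrier R" if "m \<in> M" for m using that M.Icarr by blast
  have unit: "u \<notin> M" if "u \<in> Units R" for u
  proof
    assume "u \<in> M"
    then have "inv u \<otimes> u \<in> M" by (rule M.I_l_closed) (use that in simp)
    then show False using that M.one_imp_carrier M.I_notcarr by auto
  qed
  have nonunit: "a \<in> M" if "a \<in> carrier R" "a \<notin> Units R" for a
    using nonunit_in_maximalideal[OF fin that] uniq by blast
  show ?thesis
  proof
    show "additive_subgroup (x <# M) R"
      using additive_subgroup_l_coset[OF M.is_additive_subgroup x(1)] .
    show "x <# M \<subseteq> x <# carrier R" unfolding l_coset_def using Mc by blast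
    \<comment> \<open>If \<open>x u = x m\<close> with \<open>m\<close> in \<open>M\<close>, then
      \<open>u - m\<close> lies outside \<open>M\<close> and is a unit annihilating
      \<open>x\<close>, which contradicts \<open>x \<noteq> \<zero>\<close>.\<close>
    have "x \<otimes> u \<notin> x <# M" if u: "u \<in> Units R" for u
    proof
      assume "x \<otimes> u \<in> x <# M"
      then obtain m where m: "m \<in> M" "x \<otimes> u = x \<otimes> m" by (auto simp: l_coset_def)
      have d: "u \<ominus> m \<in> carrier R" using u m Mc by (simp add: Units_closed)
      have "u \<ominus> m \<notin> M"
        using minus_mem_additive_subgroup_iff[OF M.is_additive_subgroup Units_closed[OF u] m(1)] unit[OF u] by simp
      then have v: "u \<ominus> m \<in> Units R" using nonunit d by blast
      have "x \<otimes> (u \<ominus> m) = \<zero>"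
        using m u x Mc by (simp add: a_minus_def r_distr r_minus Units_closed r_neg)
      then have "x \<otimes> (u \<ominus> m) \<otimes> inv (u \<ominus> m) = \<zero>" using v by simp
      then show False using v x d by (simp add: m_assoc)
    qed
    then show "x <# Units R = (x <# carrier R) - (x <# M)"
      using nonunit Units_closed unfolding l_coset_def by blast
  qed
qed

text \<open>Every factor gets the same index set of three weights and eigenvalues, as the product
  argument requires. The second sum is the energy of the factor divided by the order of the
  ring.\<close>

lemma (in cring) local_ring_sum_reps:
  assumes loc: "local_ring R" and fin: "finite (carrier R)" and x: "x \<in> carrier R"
  shows "\<exists>w c :: nat \<Rightarrow> complex. (\<forall>m. sum_reps R (x <# Units R) m \<zero> = (\<Sum>k<3. w k * c k ^ m)) \<and>
    (\<Sum>k<3. w k * of_real (cmod (c k))) =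
      (if x = \<zero> then 1 else 2) * of_nat (card (x <# Units R)) / of_nat (card (x <# carrier R))"
proof (cases "x = \<zero>")
  case True
  then have "x <# Units R = {\<zero>}" "x <# carrier R = {\<zero>}"
    using Units_closed by (force simp: l_coset_def)+
  then show ?thesis
    \<comment> \<open>The same function serves as \<open>w\<close> and \<open>c\<close>: eigenvalue
      1 with weight 1. The padding needs weight 0 because \<open>0 ^ 0 = 1\<close>.\<close>
    by (intro exI[of _ "\<lambda>k. of_bool (k = 0)"]) (simp add: True sum_reps_zero numeral_3_eq_3)
next
  case False
  define I where "I = x <# carrier R"
  obtain J where J: "additive_subgroup J R" "J \<subseteq> I" "x <# Units R = I - J"
    unfolding I_def by (rule local_ring_l_coset_Units[OF loc fin x False])
  have I: "additive_subgroup I R"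
    unfolding I_def using additive_subgroup_l_coset[OF ideal.axioms(1)[OF oneideal] x] .
  let ?i = "of_nat (card I) :: complex" and ?j = "of_nat (card J) :: complex"
  have finI: "finite I" by (rule finite_subset[OF additive_subgroup.a_subset[OF I] fin])
  have finJ: "finite J" by (rule finite_subset[OF J(2) finI])
  have zI: "\<zero> \<in> I" and zJ: "\<zero> \<in> J"
    by (rule additive_subgroup.zero_closed[OF I], rule additive_subgroup.zero_closed[OF J(1)])
  then have ne: "?i \<noteq> 0" "?j \<noteq> 0" using finI finJ by auto
  have ij: "?i - ?j = of_nat (card (I - J))"
    using card_mono[OF finI J(2)] J finJ by (simp add: card_Diff_subset of_nat_diff)
  \<comment> \<open>Read off from \<open>sum_reps_subgroup_diff\<close> at
    \<open>z = \<zero>\<close>, where all three indicators are 1.\<close>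
  define w where "w k = (if k = 0 then 1 / ?i else if k = 1 then 1 / ?j - 1 / ?i else 1 - 1 / ?j)" for k :: nat
  define c where "c k = (if k = 0 then ?i - ?j else if k = 1 then - ?j else 0)" for k :: nat
  have "sum_reps R (I - J) m \<zero> = (\<Sum>k<3. w k * c k ^ m)" for m
    using sum_reps_subgroup_diff[OF I J(1,2) fin zero_closed, of m] zI zJ
    by (simp add: w_def c_def numeral_3_eq_3)
  \<comment> \<open>Writing i and j for the two cardinalities, (i - j)/i + (1/j - 1/i) j = 2 (i -
    j)/i. By \<open>ij\<close> the number i - j is a cardinality, hence equal to its
    modulus.\<close>
  moreover have "(\<Sum>k<3. w k * of_real (cmod (c k))) = 2 * of_nat (card (I - J)) / ?i"
    using ne unfolding ij[symmetric]
    by (simp add: w_def c_def numeral_3_eq_3 ij) (simp add: ij[symmetric] field_simps)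
  ultimately show ?thesis
    using False by (auto simp: J(3) I_def[symmetric])
qed

section \<open>Products\<close>

lemma nth_ring_hom:
  "i < length Rs \<Longrightarrow> (\<lambda>as. as ! i) \<in> Ring.ring_hom (RDirProd_list Rs) (Rs ! i)"
proof (induction Rs arbitrary: i)
  case Nil
  then show ?case by simp
next
  case (Cons S Rs)
  \<comment> \<open>The componentwise operations are obtained from the homomorphism of the binary
    product of \<open>S\<close> and \<open>RDirProd_list Rs\<close> that conses a pair.\<close>
  have mult: "(a # as) \<otimes>\<^bsub>RDirProd_list (S # Rs)\<^esub> (b # bs) =
      (a \<otimes>\<^bsub>S\<^esub> b) # (as \<otimes>\<^bsub>RDirProd_list Rs\<^esub> bs)"
    and add: "(a # as) \<oplus>\<^bsub>RDirProd_list (S # Rs)\<^esub> (b # bs) =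
      (a \<oplus>\<^bsub>S\<^esub> b) # (as \<oplus>\<^bsub>RDirProd_list Rs\<^esub> bs)"
    if "a \<in> carrier S" "b \<in> carrier S" "as \<in> carrier (RDirProd_list Rs)" "bs \<in> carrier (RDirProd_list Rs)"
    for a b as bs
    using that ring_hom_mult[OF RDirProd_list_hom1, of "(a, as)" S Rs "(b, bs)"]
      ring_hom_add[OF RDirProd_list_hom1, of "(a, as)" S Rs "(b, bs)"]
    by (simp_all add: RDirProd_def DirProd_def monoid.defs)
  have one: "\<one>\<^bsub>RDirProd_list (S # Rs)\<^esub> = \<one>\<^bsub>S\<^esub> # \<one>\<^bsub>RDirProd_list Rs\<^esub>"
    by (simp add: RDirProd_list_one)
  show ?case
  proof (cases i)
    case 0
    then show ?thesis
      by (intro ring_hom_memI) (auto simp: RDirProd_list_carrier mult add one)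
  next
    case (Suc k)
    then have k: "(\<lambda>as. as ! k) \<in> Ring.ring_hom (RDirProd_list Rs) (Rs ! k)"
      using Cons by simp
    show ?thesis
      unfolding Suc
      by (intro ring_hom_memI)
        (auto simp: RDirProd_list_carrier mult add one ring_hom_closed[OF k] ring_hom_mult[OF k]
          ring_hom_add[OF k] ring_hom_one[OF k])
  qed
qed

lemma (in ring) l_coset_subset_carrier:
  "V \<subseteq> carrier R \<Longrightarrow> x \<in> carrier R \<Longrightarrow> x <# V \<subseteq> carrier R"
  by (auto simp: l_coset_def)

text \<open>A product decomposition given by its coordinate maps. The target consists of extensional
  functions, so that a product of sums expands into a sum over \<open>PiE\<close>.\<close>

locale finite_ring_product = cring R for R :: "('a, 'c) ring_scheme" (structure) +
  fixes n :: nat and T :: "nat \<Rightarrow> ('b, 'm) ring_scheme" and \<pi> :: "nat \<Rightarrow> 'a \<Rightarrow> 'b"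
  assumes finite_carrier: "finite (carrier R)"
    and factor_cring: "i < n \<Longrightarrow> cring (T i)"
    and proj_hom: "i < n \<Longrightarrow> \<pi> i \<in> Ring.ring_hom R (T i)"
    and bij_proj: "bij_betw (\<lambda>r. \<lambda>i\<in>{..<n}. \<pi> i r) (carrier R) (\<Pi>\<^sub>E i\<in>{..<n}. carrier (T i))"
begin

abbreviation proj :: "'a \<Rightarrow> nat \<Rightarrow> 'b" where
  "proj r \<equiv> \<lambda>i\<in>{..<n}. \<pi> i r"

lemma proj_ring_hom_ring: "i < n \<Longrightarrow> ring_hom_ring R (T i) (\<pi> i)"
  using ring_hom_ringI2[OF ring_axioms cring.axioms(1)[OF factor_cring] proj_hom] by blast

lemma proj_eqI:
  assumes "r \<in> carrier R" "s \<in> carrier R" "\<And>i. i < n \<Longrightarrow> \<pi> i r = \<pi> i s"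
  shows "r = s"
  using bij_betw_imp_inj_on[OF bij_proj] assms by (auto simp: inj_on_def intro!: restrict_ext)

lemma proj_surj:
  assumes "\<And>i. i < n \<Longrightarrow> g i \<in> carrier (T i)"
  obtains r where "r \<in> carrier R" "\<And>i. i < n \<Longrightarrow> \<pi> i r = g i"
proof -
  have "restrict g {..<n} \<in> proj ` carrier R"
    unfolding bij_betw_imp_surj_on[OF bij_proj] using assms by auto
  then obtain r where r: "r \<in> carrier R" "restrict g {..<n} = proj r" by blast
  show ?thesis
  proof (rule that[OF r(1)])
    fix i assume "i < n"
    then show "\<pi> i r = g i" using fun_cong[OF r(2), of i] by simp
  qed
qed

text \<open>A subset defined coordinate by coordinate corresponds to a box, so its cardinality and
  sums over it factorize.\<close>

lemma bij_betw_proj_iff: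
  assumes U: "U \<subseteq> carrier R" and V: "\<And>i. i < n \<Longrightarrow> V i \<subseteq> carrier (T i)"
    and iff: "\<And>r. r \<in> carrier R \<Longrightarrow> r \<in> U \<longleftrightarrow> (\<forall>i<n. \<pi> i r \<in> V i)"
  shows "bij_betw proj U (\<Pi>\<^sub>E i\<in>{..<n}. V i)"
proof (rule bij_betw_imageI)
  show "inj_on proj U"
    using inj_on_subset[OF bij_betw_imp_inj_on[OF bij_proj] U] .
  show "proj ` U = (\<Pi>\<^sub>E i\<in>{..<n}. V i)"
  proof (intro equalityI subsetI)
    fix g assume g: "g \<in> (\<Pi>\<^sub>E i\<in>{..<n}. V i)"
    have "g i \<in> carrier (T i)" if "i < n" for i using g V[OF that] that by blast
    then obtain r where r: "r \<in> carrier R" "\<And>i. i < n \<Longrightarrow> \<pi> i r = g i" using proj_surj by blast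
    have "r \<in> U" using iff[OF r(1)] r(2) g by (auto simp: PiE_def Pi_def)
    moreover have "g = proj r" using g r(2) by (intro ext) (auto simp: PiE_def extensional_def)
    ultimately show "g \<in> proj ` U" by blast
  next
    fix g assume "g \<in> proj ` U"
    then obtain r where r: "r \<in> U" "g = proj r" by blast
    have "\<forall>i<n. \<pi> i r \<in> V i" using iff[of r] r(1) U by blast
    then show "g \<in> (\<Pi>\<^sub>E i\<in>{..<n}. V i)" unfolding r(2) by auto
  qed
qed

text \<open>Homomorphisms preserve units. Conversely, inverses chosen in the factors lift to one
  element \<open>s\<close> by surjectivity, and injectivity yields
  \<open>r \<otimes> s = \<one>\<close>.\<close>

lemma Units_iff_proj:
  assumes r: "r \<in> carrier R"
  shows "r \<in> Units R \<longleftrightarrow> (\<forall>i<n. \<pi> i r \<in> Units (T i))"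
proof (intro iffI allI impI)
  fix i assume u: "r \<in> Units R" and i: "i < n"
  interpret h: ring_hom_ring R "T i" "\<pi> i" using proj_ring_hom_ring[OF i] .
  have "\<pi> i r \<otimes>\<^bsub>T i\<^esub> \<pi> i (inv r) = \<one>\<^bsub>T i\<^esub>" "\<pi> i (inv r) \<otimes>\<^bsub>T i\<^esub> \<pi> i r = \<one>\<^bsub>T i\<^esub>"
    using u r h.hom_mult[of r "inv r"] h.hom_mult[of "inv r" r] by simp_all
  then show "\<pi> i r \<in> Units (T i)"
    using u r unfolding Units_def[of "T i"] by (auto intro!: bexI[of _ "\<pi> i (inv r)"])
next
  assume a: "\<forall>i<n. \<pi> i r \<in> Units (T i)"
  have "\<exists>v. v \<in> carrier (T i) \<and> \<pi> i r \<otimes>\<^bsub>T i\<^esub> v = \<one>\<^bsub>T i\<^esub>" if "i < n" for i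
    using a that unfolding Units_def by blast
  then obtain v where v: "\<And>i. i < n \<Longrightarrow> v i \<in> carrier (T i)"
      "\<And>i. i < n \<Longrightarrow> \<pi> i r \<otimes>\<^bsub>T i\<^esub> v i = \<one>\<^bsub>T i\<^esub>" by metis
  obtain s where s: "s \<in> carrier R" "\<And>i. i < n \<Longrightarrow> \<pi> i s = v i" using proj_surj[of v] v(1) by blast
  have "r \<otimes> s = \<one>"
  proof (rule proj_eqI)
    fix i assume i: "i < n"
    interpret h: ring_hom_ring R "T i" "\<pi> i" using proj_ring_hom_ring[OF i] .
    show "\<pi> i (r \<otimes> s) = \<pi> i \<one>" using r s i v by simp
  qed (use r s in auto)
  then show "r \<in> Units R"
    using r s m_comm[of r s] unfolding Units_def by auto
qed

text \<open>Stated for a general coordinatewise set \<open>U\<close>, so that it applies both to the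
  units and to the whole carrier.\<close>

lemma l_coset_iff_proj:
  assumes U: "U \<subseteq> carrier R" and V: "\<And>i. i < n \<Longrightarrow> V i \<subseteq> carrier (T i)"
    and iff: "\<And>r. r \<in> carrier R \<Longrightarrow> r \<in> U \<longleftrightarrow> (\<forall>i<n. \<pi> i r \<in> V i)"
    and x: "x \<in> carrier R" and r: "r \<in> carrier R"
  shows "r \<in> x <# U \<longleftrightarrow> (\<forall>i<n. \<pi> i r \<in> \<pi> i x <#\<^bsub>T i\<^esub> V i)"
proof (intro iffI allI impI)
  fix i assume "r \<in> x <# U" and i: "i < n"
  then obtain u where u: "u \<in> U" "r = x \<otimes> u" unfolding l_coset_def by blast
  have uc: "u \<in> carrier R" using u U by blast
  have "\<pi> i r = \<pi> i x \<otimes>\<^bsub>T i\<^esub> \<pi> i u"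
    unfolding u(2) by (rule ring_hom_mult[OF proj_hom[OF i] x uc])
  then show "\<pi> i r \<in> \<pi> i x <#\<^bsub>T i\<^esub> V i"
    using iff[OF uc] u(1) i unfolding l_coset_def by blast
next
  assume a: "\<forall>i<n. \<pi> i r \<in> \<pi> i x <#\<^bsub>T i\<^esub> V i"
  have "\<exists>v. v \<in> V i \<and> \<pi> i r = \<pi> i x \<otimes>\<^bsub>T i\<^esub> v" if "i < n" for i
    using a that unfolding l_coset_def by blast
  then obtain v where v: "\<And>i. i < n \<Longrightarrow> v i \<in> V i" "\<And>i. i < n \<Longrightarrow> \<pi> i r = \<pi> i x \<otimes>\<^bsub>T i\<^esub> v i"
    by metis
  obtain u where u: "u \<in> carrier R" "\<And>i. i < n \<Longrightarrow> \<pi> i u = v i"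
    using proj_surj[of v] v(1) V by blast
  have "r = x \<otimes> u"
  proof (rule proj_eqI)
    fix i assume i: "i < n"
    show "\<pi> i r = \<pi> i (x \<otimes> u)"
      using v(2)[OF i] u(2)[OF i] ring_hom_mult[OF proj_hom[OF i] x u(1)] by simp
  qed (use r x u in auto)
  moreover have "u \<in> U" using iff[OF u(1)] u(2) v(1) by simp
  ultimately show "r \<in> x <# U" unfolding l_coset_def by blast
qed

lemma factor_l_coset_subset:
  assumes "x \<in> carrier R" "i < n" "V \<subseteq> carrier (T i)"
  shows "\<pi> i x <#\<^bsub>T i\<^esub> V \<subseteq> carrier (T i)"
  using ring.l_coset_subset_carrier[OF cring.axioms(1)[OF factor_cring[OF assms(2)]] assms(3)
      ring_hom_closed[OF proj_hom[OF assms(2)] assms(1)]] .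

text \<open>An \<open>m\<close>-tuple from \<open>S\<close> with sum \<open>z\<close> amounts to one
  \<open>m\<close>-tuple from each \<open>V i\<close> with sum \<open>\<pi> i z\<close>, so the
  counts multiply.\<close>

lemma sum_reps_product:
  assumes S: "S \<subseteq> carrier R" and bij: "bij_betw proj S (\<Pi>\<^sub>E i\<in>{..<n}. V i)"
    and V: "\<And>i. i < n \<Longrightarrow> finite (V i)"
    and z: "z \<in> carrier R"
  shows "sum_reps R S m z = (\<Prod>i<n. sum_reps (T i) (V i) m (\<pi> i z))"
  using z
proof (induction m arbitrary: z)
  case 0
  have "z = \<zero> \<longleftrightarrow> (\<forall>i<n. \<pi> i z = \<zero>\<^bsub>T i\<^esub>)"
  proof (intro iffI allI impI)
    fix i assume "z = \<zero>" and i: "i < n"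
    interpret h: ring_hom_ring R "T i" "\<pi> i" using proj_ring_hom_ring[OF i] .
    show "\<pi> i z = \<zero>\<^bsub>T i\<^esub>" using \<open>z = \<zero>\<close> by simp
  next
    assume a: "\<forall>i<n. \<pi> i z = \<zero>\<^bsub>T i\<^esub>"
    show "z = \<zero>"
    proof (rule proj_eqI)
      fix i assume i: "i < n"
      interpret h: ring_hom_ring R "T i" "\<pi> i" using proj_ring_hom_ring[OF i] .
      show "\<pi> i z = \<pi> i \<zero>" using a i by simp
    qed (use 0 in auto)
  qed
  then show ?case
    by (cases "z = \<zero>") (auto intro!: prod.neutral prod_zero[symmetric])
next
  case (Suc m)
  have "sum_reps R S (Suc m) z =
      (\<Sum>s\<in>S. \<Prod>i<n. sum_reps (T i) (V i) m (\<pi> i z \<ominus>\<^bsub>T i\<^esub> proj s i))"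
    unfolding sum_reps.simps
  proof (intro sum.cong refl)
    fix s assume "s \<in> S"
    then have s: "s \<in> carrier R" using S by blast
    have "\<pi> i (z \<ominus> s) = \<pi> i z \<ominus>\<^bsub>T i\<^esub> \<pi> i s" if i: "i < n" for i
    proof -
      interpret h: ring_hom_ring R "T i" "\<pi> i" using proj_ring_hom_ring[OF i] .
      show ?thesis using s Suc.prems by (simp add: a_minus_def)
    qed
    then show "sum_reps R S m (z \<ominus> s) = (\<Prod>i<n. sum_reps (T i) (V i) m (\<pi> i z \<ominus>\<^bsub>T i\<^esub> proj s i))"
      using Suc.IH[of "z \<ominus> s"] s Suc.prems by simp
  qed
  also have "\<dots> = (\<Sum>g\<in>Pi\<^sub>E {..<n} V. \<Prod>i<n. sum_reps (T i) (V i) m (\<pi> i z \<ominus>\<^bsub>T i\<^esub> g i))"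
    by (rule sum.reindex_bij_betw[OF bij])
  \<comment> \<open>Distributivity: a sum over the box of products of one-coordinate terms is a
    product of sums.\<close>
  also have "\<dots> = (\<Prod>i<n. \<Sum>v\<in>V i. sum_reps (T i) (V i) m (\<pi> i z \<ominus>\<^bsub>T i\<^esub> v))"
    by (rule prod_sum_PiE[symmetric]) (use V in auto)
  finally show ?case by simp
qed

lemma finite_factor: "i < n \<Longrightarrow> finite (carrier (T i))"
proof -
  assume i: "i < n"
  have "carrier (T i) \<subseteq> \<pi> i ` carrier R"
  proof
    fix t assume t: "t \<in> carrier (T i)"
    \<comment> \<open>The element \<open>t\<close>, extended by zeros in the other coordinates, is
      lifted to a preimage in \<open>R\<close>.\<close>
    have "(if j = i then t else \<zero>\<^bsub>T j\<^esub>) \<in> carrier (T j)" if "j < n" for j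
      using t cring.cring_simprules(2)[OF factor_cring[OF that]] by simp
    then obtain r where "r \<in> carrier R" "\<And>j. j < n \<Longrightarrow> \<pi> j r = (if j = i then t else \<zero>\<^bsub>T j\<^esub>)"
      using proj_surj[of "\<lambda>j. if j = i then t else \<zero>\<^bsub>T j\<^esub>"] by blast
    then show "t \<in> \<pi> i ` carrier R" using i by force
  qed
  then show ?thesis using finite_carrier finite_surj by blast
qed

lemma bij_betw_proj_l_coset_Units:
  assumes "x \<in> carrier R"
  shows "bij_betw proj (x <# Units R) (\<Pi>\<^sub>E i\<in>{..<n}. \<pi> i x <#\<^bsub>T i\<^esub> Units (T i))"
proof (rule bij_betw_proj_iff)
  have U: "Units R \<subseteq> carrier R" and V: "Units (T i) \<subseteq> carrier (T i)" for i
    by (auto simp: Units_def)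
  show "x <# Units R \<subseteq> carrier R" using l_coset_subset_carrier[OF U assms] .
  show "\<pi> i x <#\<^bsub>T i\<^esub> Units (T i) \<subseteq> carrier (T i)" if "i < n" for i
    by (rule factor_l_coset_subset[OF assms that V])
  show "r \<in> x <# Units R \<longleftrightarrow> (\<forall>i<n. \<pi> i r \<in> \<pi> i x <#\<^bsub>T i\<^esub> Units (T i))"
    if "r \<in> carrier R" for r
    by (rule l_coset_iff_proj[OF U V Units_iff_proj assms that])
qed

lemma bij_betw_proj_l_coset_carrier:
  assumes "x \<in> carrier R"
  shows "bij_betw proj (x <# carrier R) (\<Pi>\<^sub>E i\<in>{..<n}. \<pi> i x <#\<^bsub>T i\<^esub> carrier (T i))"
proof (rule bij_betw_proj_iff)
  show "x <# carrier R \<subseteq> carrier R" using l_coset_subset_carrier[OF subset_refl assms] .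
  show "\<pi> i x <#\<^bsub>T i\<^esub> carrier (T i) \<subseteq> carrier (T i)" if "i < n" for i
    by (rule factor_l_coset_subset[OF assms that subset_refl])
  have "r \<in> carrier R \<longleftrightarrow> (\<forall>i<n. \<pi> i r \<in> carrier (T i))" if "r \<in> carrier R" for r
    using that ring_hom_closed[OF proj_hom] by blast
  then show "r \<in> x <# carrier R \<longleftrightarrow> (\<forall>i<n. \<pi> i r \<in> \<pi> i x <#\<^bsub>T i\<^esub> carrier (T i))"
    if "r \<in> carrier R" for r
    by (rule l_coset_iff_proj[OF subset_refl subset_refl _ assms that])
qed

text \<open>Expanding the product of the factor expansions gives weights and eigenvalues indexed by
  functions \<open>g\<close> that choose one of three terms per factor. The modulus is
  multiplicative, so the energy factorizes again, with a factor 2 from each nonzero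
  component.\<close>

lemma graph_energy_Cay_l_coset_Units:
  assumes loc: "\<And>i. i < n \<Longrightarrow> local_ring (T i)" and x: "x \<in> carrier R"
  shows "graph_energy (Cay R (x <# Units R)) =
    2 ^ card {i. i < n \<and> \<pi> i x \<noteq> \<zero>\<^bsub>T i\<^esub>} *
      (real (card (carrier R)) * real (card (x <# Units R)) / real (card (x <# carrier R)))"
proof -
  define S where "S i = \<pi> i x <#\<^bsub>T i\<^esub> Units (T i)" for i
  define I where "I i = \<pi> i x <#\<^bsub>T i\<^esub> carrier (T i)" for i
  define b where "b i = (if \<pi> i x = \<zero>\<^bsub>T i\<^esub> then 1 else 2 :: complex)" for i
  have bijS: "bij_betw proj (x <# Units R) (\<Pi>\<^sub>E i\<in>{..<n}. S i)"
    unfolding S_def by (rule bij_betw_proj_l_coset_Units[OF x])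
  have bijI: "bij_betw proj (x <# carrier R) (\<Pi>\<^sub>E i\<in>{..<n}. I i)"
    unfolding I_def by (rule bij_betw_proj_l_coset_carrier[OF x])
  have SR: "x <# Units R \<subseteq> carrier R"
    by (rule l_coset_subset_carrier[OF _ x]) (auto simp: Units_def)
  have finS: "finite (S i)" if "i < n" for i
    unfolding S_def
    by (rule finite_subset[OF factor_l_coset_subset[OF x that] finite_factor[OF that]])
      (auto simp: Units_def)
  define Q where "Q i w c \<longleftrightarrow>
      (\<forall>m. sum_reps (T i) (S i) m \<zero>\<^bsub>T i\<^esub> = (\<Sum>k<3. w k * c k ^ m)) \<and>
      (\<Sum>k<3. w k * of_real (cmod (c k))) = b i * of_nat (card (S i)) / of_nat (card (I i))"
    for i and w c :: "nat \<Rightarrow> complex"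
  have "\<exists>w c. Q i w c" if i: "i < n" for i
    unfolding Q_def S_def I_def b_def
    by (rule cring.local_ring_sum_reps[OF factor_cring[OF i] loc[OF i] finite_factor[OF i]
          ring_hom_closed[OF proj_hom[OF i] x]])
  then obtain w c where "\<And>i. i < n \<Longrightarrow> Q i (w i) (c i)"
    by metis
  then have reps: "sum_reps (T i) (S i) m \<zero>\<^bsub>T i\<^esub> = (\<Sum>k<3. w i k * c i k ^ m)"
    and energy: "(\<Sum>k<3. w i k * of_real (cmod (c i k))) = b i * of_nat (card (S i)) / of_nat (card (I i))"
    if "i < n" for i m
    using that unfolding Q_def by blast+
  let ?G = "\<Pi>\<^sub>E i\<in>{..<n}. {..<3::nat}"
  let ?W = "\<lambda>g. \<Prod>i<n. w i (g i)" and ?C = "\<lambda>g. \<Prod>i<n. c i (g i)"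
  have finG: "finite ?G" by (intro finite_PiE) auto
  have "sum_reps R (x <# Units R) m \<zero> = (\<Sum>g\<in>?G. ?W g * ?C g ^ m)" for m
  proof -
    have "\<pi> i \<zero> = \<zero>\<^bsub>T i\<^esub>" if i: "i < n" for i
    proof -
      interpret h: ring_hom_ring R "T i" "\<pi> i" using proj_ring_hom_ring[OF i] .
      show ?thesis by simp
    qed
    then have "sum_reps R (x <# Units R) m \<zero> = (\<Prod>i<n. \<Sum>k<3. w i k * c i k ^ m)"
      using sum_reps_product[OF SR bijS finS zero_closed, of m] reps by simp
    also have "\<dots> = (\<Sum>g\<in>?G. \<Prod>i<n. w i (g i) * c i (g i) ^ m)"
      by (rule prod_sum_PiE) auto
    finally show ?thesis by (simp add: prod.distrib prod_power_distrib)
  qed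
  then have "complex_of_real (graph_energy (Cay R (x <# Units R))) =
      of_nat (card (carrier R)) * (\<Sum>g\<in>?G. ?W g * of_real (cmod (?C g)))"
    by (rule graph_energy_Cay[OF finite_carrier SR finG])
  also have "(\<Sum>g\<in>?G. ?W g * of_real (cmod (?C g))) =
      (\<Sum>g\<in>?G. \<Prod>i<n. w i (g i) * of_real (cmod (c i (g i))))"
    by (simp add: prod_norm[symmetric] prod.distrib)
  \<comment> \<open>The same expansion read backwards, now with moduli instead of powers.\<close>
  also have "\<dots> = (\<Prod>i<n. \<Sum>k<3. w i k * of_real (cmod (c i k)))"
    by (rule prod_sum_PiE[symmetric]) auto
  also have "\<dots> = (\<Prod>i<n. b i) * (\<Prod>i<n. of_nat (card (S i))) / (\<Prod>i<n. of_nat (card (I i)))"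
    by (simp add: energy prod.distrib prod_dividef)
  also have "(\<Prod>i<n. b i) = 2 ^ card {i. i < n \<and> \<pi> i x \<noteq> \<zero>\<^bsub>T i\<^esub>}"
  proof -
    have "(\<Prod>i<n. b i) = (\<Prod>i\<in>{i \<in> {..<n}. \<pi> i x \<noteq> \<zero>\<^bsub>T i\<^esub>}. 2)"
      unfolding prod.inter_filter[OF finite_lessThan] by (intro prod.cong) (auto simp: b_def)
    then show ?thesis by simp
  qed
  also have "(\<Prod>i<n. of_nat (card (S i))) = (of_nat (card (x <# Units R)) :: complex)"
    using bij_betw_same_card[OF bijS] by (simp add: card_PiE)
  also have "(\<Prod>i<n. of_nat (card (I i))) = (of_nat (card (x <# carrier R)) :: complex)"
    using bij_betw_same_card[OF bijI] by (simp add: card_PiE)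
  finally have "complex_of_real (graph_energy (Cay R (x <# Units R))) =
      complex_of_real (2 ^ card {i. i < n \<and> \<pi> i x \<noteq> \<zero>\<^bsub>T i\<^esub>} *
        (real (card (carrier R)) * real (card (x <# Units R)) / real (card (x <# carrier R))))"
    by (simp add: mult_ac)
  then show ?thesis unfolding of_real_eq_iff .
qed

end

text \<open>Links the product encoded by lists to the extensional functions of the locale; the
  inverse tabulates a function as a list.\<close>

lemma bij_betw_nth_RDirProd_list:
  "bij_betw (\<lambda>as. \<lambda>i\<in>{..<length Rs}. as ! i) (carrier (RDirProd_list Rs))
    (\<Pi>\<^sub>E i\<in>{..<length Rs}. carrier (Rs ! i))"
proof (rule bij_betw_byWitness[of _ "\<lambda>g. map g [0..<length Rs]"])
  show "\<forall>as\<in>carrier (RDirProd_list Rs).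
      map (\<lambda>i\<in>{..<length Rs}. as ! i) [0..<length Rs] = as"
    using RDirProd_list_carrier_mem(1)[of _ Rs] by (auto intro!: nth_equalityI)
  show "\<forall>g\<in>\<Pi>\<^sub>E i\<in>{..<length Rs}. carrier (Rs ! i).
      (\<lambda>i\<in>{..<length Rs}. map g [0..<length Rs] ! i) = g"
    by (auto intro!: ext simp: PiE_def extensional_def)
  show "(\<lambda>as. \<lambda>i\<in>{..<length Rs}. as ! i) ` carrier (RDirProd_list Rs)
      \<subseteq> (\<Pi>\<^sub>E i\<in>{..<length Rs}. carrier (Rs ! i))"
    using RDirProd_list_carrier_mem(2)[of _ Rs] by (intro image_subsetI restrict_PiE_iff[THEN iffD2]) auto
  show "(\<lambda>g. map g [0..<length Rs]) ` (\<Pi>\<^sub>E i\<in>{..<length Rs}. carrier (Rs ! i))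
      \<subseteq> carrier (RDirProd_list Rs)"
  proof (intro image_subsetI RDirProd_list_carrier_memI)
    fix g i assume g: "g \<in> (\<Pi>\<^sub>E i\<in>{..<length Rs}. carrier (Rs ! i))" and i: "i < length Rs"
    show "map g [0..<length Rs] ! i \<in> carrier (Rs ! i)" using PiE_mem[OF g, of i] i by simp
  qed simp
qed

theorem theorem3p9:
  fixes R :: "('r, 'm) ring_scheme"
    and Rs :: "('a, 'n) ring_scheme list"
    and \<phi> :: "'r \<Rightarrow> 'a list"
    and x :: 'r
  assumes "cring R" and "finite (carrier R)"
    and "\<And>i. i < length Rs \<Longrightarrow> local_ring (Rs ! i) \<and> finite (carrier (Rs ! i))"
    and "\<phi> \<in> ring_iso R (RDirProd_list Rs)"
    and "x \<in> carrier R" and "x \<noteq> \<zero>\<^bsub>R\<^esub>"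
  shows "graph_energy (Cay R (x <#\<^bsub>R\<^esub> Units R)) =
    2 ^ card {i. i < length Rs \<and> \<phi> x ! i \<noteq> \<zero>\<^bsub>Rs ! i\<^esub>} *
      (real (card (carrier R)) * real (card (x <#\<^bsub>R\<^esub> Units R))
      / real (card (Idl\<^bsub>R\<^esub> {x})))"
proof -
  have hom: "\<phi> \<in> Ring.ring_hom R (RDirProd_list Rs)"
    and bij: "bij_betw \<phi> (carrier R) (carrier (RDirProd_list Rs))"
    using assms(4) by (auto simp: ring_iso_def)
  interpret cring R by fact
  interpret finite_ring_product R "length Rs" "\<lambda>i. Rs ! i" "\<lambda>i r. \<phi> r ! i"
  proof (intro finite_ring_product.intro finite_ring_product_axioms.intro)
    show "cring R" "finite (carrier R)" by fact+
    show "cring (Rs ! i)" if "i < length Rs" for i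
      using assms(3)[OF that] by (simp add: local_ring_def)
    show "(\<lambda>r. \<phi> r ! i) \<in> Ring.ring_hom R (Rs ! i)" if "i < length Rs" for i
      using ring_hom_trans[OF hom nth_ring_hom[OF that]] by (simp add: comp_def)
    show "bij_betw (\<lambda>r. \<lambda>i\<in>{..<length Rs}. \<phi> r ! i) (carrier R)
        (\<Pi>\<^sub>E i\<in>{..<length Rs}. carrier (Rs ! i))"
      using bij_betw_trans[OF bij bij_betw_nth_RDirProd_list] by (simp add: comp_def)
  qed
  \<comment> \<open>In a commutative ring the generated ideal is the set of multiples of
    \<open>x\<close>, the form in which the energy formula was derived.\<close>
  have "Idl\<^bsub>R\<^esub> {x} = x <#\<^bsub>R\<^esub> carrier R"
    unfolding cgenideal_eq_genideal[OF assms(5), symmetric]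
    using assms(5) m_comm by (force simp: cgenideal_def l_coset_def)
  then show ?thesis
    using graph_energy_Cay_l_coset_Units[OF _ assms(5)] assms(3) by simp
qed

end
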